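(* Let $\mathcal{A},\mathcal{B}$ be sets, $d\geq 1$ an integer, $\mathcal{R}$ a set of functions from $\mathcal{A}\times\mathcal{B}$ to $\mathbb{R}^d$, $\mathcal{C}\subset\mathbb{R}^d$ a closed convex cone, and $(\langle\cdot,\cdot\rangle_{(t)})_{t\geq 1}$ a sequence of inner products on $\mathbb{R}^d$ with associated norms $(\|\cdot\|_{(t)})_{t\geq 1}$. Assume that the family of norms is nonincreasing, i.e. $\|u\|_{(t+1)}\leq\|u\|_{(t)}$ for all $u\in\mathbb{R}^d$ and $t\geq 1$, and that $\mathcal{C}$ satisfies Blackwell's condition with respect to $\mathcal{R}$ and $(\langle\cdot,\cdot\rangle_{(t)})_{t\geq 1}$. Then Blackwell's algorithm associated with a corresponding oracle (and any first action $a_1\in\mathcal{A}$) guarantees that, for every sequence of outcome functions $(\rho_t)_{t\geq 1}$ in $\mathcal{R}$ and every sequence $(b_t)_{t\geq 1}$ in $\mathcal{B}$, the resulting outcome vectors $r_t=\rho_t(a_t,b_t)$ satisfy, for all $T\geq 1$, $$\min_{r\in\mathcal{C}}\left\|\frac1T\sum_{t=1}^T r_t-r\right\|_{(T)}\leq\frac1T\sqrt{\sum_{t=1}^T\|r_t\|_{(t)}^2}.$$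
   Context: A nonempty subset $\mathcal{C}\subset\mathbb{R}^d$ is a closed convex cone if it is closed and for all $z,z'\in\mathcal{C}$ and $\lambda\geq 0$, $z+z'\in\mathcal{C}$ and $\lambda z\in\mathcal{C}$. For $t\geq 1$, $\|r\|_{(t)}=\langle r,r\rangle_{(t)}^{1/2}$ and $\pi_{(t)}^{\mathcal{C}}(r)=\arg\min_{r'\in\mathcal{C}}\|r'-r\|_{(t)}$ is the projection onto $\mathcal{C}$ for this norm. Blackwell's condition: $\mathcal{C}$ satisfies Blackwell's condition with respect to $\mathcal{R}$ and $(\langle\cdot,\cdot\rangle_{(t)})_{t\geq 1}$ if for all $t\geq 1$, $\rho\in\mathcal{R}$, $r\in\mathbb{R}^d$, there exists $a[t,\rho,r]\in\mathcal{A}$ such that for all $b\in\mathcal{B}$, $\langle\rho(a[t,\rho,r],b),\,r-\pi_{(t)}^{\mathcal{C}}(r)\rangle_{(t)}\leq 0$. Such a map $(t,\rho,r)\mapsto a[t,\rho,r]$ is called an oracle associated with $\mathcal{C}$, $\mathcal{R}$ and $(\langle\cdot,\cdot\rangle_{(t)})_{t\geq 1}$. Blackwell's algorithm associated with an oracle $a$ and a first action $a_1\in\mathcal{A}$: given sequences $(\rho_t)_{t\geq1}$ in $\mathcal{R}$ and $(b_t)_{t\geq 1}$ in $\mathcal{B}$, the Decision Maker's actions are $a_1$ at time $1$ and, for $t\geq 2$, $a_t=a\left[t,\rho_t,\sum_{s=1}^{t-1}r_s\right]$, where $r_s:=\rho_s(a_s,b_s)\in\mathbb{R}^d$. *)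

theory Defs
  imports "HOL-Analysis.Analysis"
begin

definition inner_product_on_space :: "('v::real_vector \<Rightarrow> 'v \<Rightarrow> real) \<Rightarrow> bool" where
  "inner_product_on_space ip \<longleftrightarrow>
     bilinear ip \<and> (\<forall>u v. ip u v = ip v u) \<and> (\<forall>u. u \<noteq> 0 \<longrightarrow> ip u u > 0)"

definition ip_norm :: "('v \<Rightarrow> 'v \<Rightarrow> real) \<Rightarrow> 'v \<Rightarrow> real" where
  "ip_norm ip u = sqrt (ip u u)"

definition closed_convex_cone :: "'v::{real_vector, topological_space} set \<Rightarrow> bool" where
  "closed_convex_cone C \<longleftrightarrow>
     C \<noteq> {} \<and> closed C \<and>
     (\<forall>z\<in>C. \<forall>z'\<in>C. \<forall>c::real. c \<ge> 0 \<longrightarrow> z + z' \<in> C \<and> c *\<^sub>R z \<in> C)"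

definition ip_projection :: "('v \<Rightarrow> 'v \<Rightarrow> real) \<Rightarrow> 'v::real_vector set \<Rightarrow> 'v \<Rightarrow> 'v" where
  "ip_projection ip C r = (ARG_MIN (\<lambda>r'. ip_norm ip (r' - r)) r'. r' \<in> C)"

text \<open>
  Outcome functions on \<open>A \<times> B\<close> are represented by total functions on pairs; they are only
  ever evaluated on \<open>A \<times> B\<close>. Sequences indexed by \<open>t \<ge> 1\<close> are functions on \<^typ>\<open>nat\<close> whose
  value at \<open>0\<close> is irrelevant.
\<close>

definition blackwell_condition ::
  "'a set \<Rightarrow> 'b set \<Rightarrow> ('a \<times> 'b \<Rightarrow> 'v::real_vector) set \<Rightarrow> (nat \<Rightarrow> 'v \<Rightarrow> 'v \<Rightarrow> real) \<Rightarrow> 'v set \<Rightarrow> bool"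
where
  "blackwell_condition A B R ip C \<longleftrightarrow>
     (\<forall>t\<ge>1. \<forall>\<rho>\<in>R. \<forall>r. \<exists>a\<in>A. \<forall>b\<in>B. ip t (\<rho> (a, b)) (r - ip_projection (ip t) C r) \<le> 0)"

definition blackwell_oracle ::
  "'a set \<Rightarrow> 'b set \<Rightarrow> ('a \<times> 'b \<Rightarrow> 'v::real_vector) set \<Rightarrow> (nat \<Rightarrow> 'v \<Rightarrow> 'v \<Rightarrow> real) \<Rightarrow> 'v set \<Rightarrow>
   (nat \<Rightarrow> ('a \<times> 'b \<Rightarrow> 'v) \<Rightarrow> 'v \<Rightarrow> 'a) \<Rightarrow> bool"
where
  "blackwell_oracle A B R ip C orc \<longleftrightarrow>
     (\<forall>t\<ge>1. \<forall>\<rho>\<in>R. \<forall>r. orc t \<rho> r \<in> A \<and>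
        (\<forall>b\<in>B. ip t (\<rho> (orc t \<rho> r, b)) (r - ip_projection (ip t) C r) \<le> 0))"

fun blackwell_action ::
  "(nat \<Rightarrow> ('a \<times> 'b \<Rightarrow> 'v::comm_monoid_add) \<Rightarrow> 'v \<Rightarrow> 'a) \<Rightarrow> 'a \<Rightarrow> (nat \<Rightarrow> 'a \<times> 'b \<Rightarrow> 'v) \<Rightarrow>
   (nat \<Rightarrow> 'b) \<Rightarrow> nat \<Rightarrow> 'a"
where
  "blackwell_action orc a1 \<rho> b t =
     (if t \<le> 1 then a1
      else orc t (\<rho> t) (\<Sum>s\<in>{1..<t}. \<rho> s (blackwell_action orc a1 \<rho> b s, b s)))"

declare blackwell_action.simps [simp del]

definition blackwell_outcome ::
  "(nat \<Rightarrow> ('a \<times> 'b \<Rightarrow> 'v::comm_monoid_add) \<Rightarrow> 'v \<Rightarrow> 'a) \<Rightarrow> 'a \<Rightarrow> (nat \<Rightarrow> 'a \<times> 'b \<Rightarrow> 'v) \<Rightarrow>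
   (nat \<Rightarrow> 'b) \<Rightarrow> nat \<Rightarrow> 'v"
where
  "blackwell_outcome orc a1 \<rho> b t = \<rho> t (blackwell_action orc a1 \<rho> b t, b t)"

lemma blackwell_action_1: "blackwell_action orc a1 \<rho> b 1 = a1"
  by (simp add: blackwell_action.simps)

lemma blackwell_action_ge_2:
  assumes "t \<ge> 2"
  shows "blackwell_action orc a1 \<rho> b t =
           orc t (\<rho> t) (\<Sum>s = 1..t - 1. blackwell_outcome orc a1 \<rho> b s)"
proof -
  have "{1..<t} = {1..t - 1}" using assms by auto
  then show ?thesis
    using assms by (subst blackwell_action.simps) (simp add: blackwell_outcome_def)
qed

end

theory Submission
  imports Defs
begin

text \<open>
  Write \<open>S\<close> for the partial sums of the outcomes and \<open>d\<^sub>t\<close> for the distance to \<open>C\<close> in the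
  \<open>t\<close>-th norm. Comparing with the projection \<open>p\<close> of \<open>S\<^sub>t\<close> in the norm \<open>t + 1\<close> and expanding the square,
  Blackwell's condition kills the cross term, so
  \<open>d\<^sub>t\<^sub>+\<^sub>1(S\<^sub>t\<^sub>+\<^sub>1)\<^sup>2 \<le> d\<^sub>t\<^sub>+\<^sub>1(S\<^sub>t)\<^sup>2 + \<parallel>r\<^sub>t\<^sub>+\<^sub>1\<parallel>\<^sup>2 \<le> d\<^sub>t(S\<^sub>t)\<^sup>2 + \<parallel>r\<^sub>t\<^sub>+\<^sub>1\<parallel>\<^sup>2\<close>,
  where the norms decrease in the last step. The induction starts from \<open>0 \<in> C\<close>, and since \<open>C\<close> is
  a cone the resulting bound for \<open>S\<^sub>T\<close> can be divided by \<open>T\<close>.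
\<close>

lemma inner_product_on_spaceD:
  assumes "inner_product_on_space ip"
  shows "bilinear ip" "ip u v = ip v u" "0 \<le> ip u u"
proof -
  show bil: "bilinear ip" and "ip u v = ip v u"
    using assms by (auto simp: inner_product_on_space_def)
  show "0 \<le> ip u u"
    using assms bilinear_lzero[OF bil, of 0]
    by (cases "u = 0") (auto simp: inner_product_on_space_def less_imp_le)
qed

lemma ip_norm_nonneg: "inner_product_on_space ip \<Longrightarrow> 0 \<le> ip_norm ip u"
  by (simp add: ip_norm_def inner_product_on_spaceD)

lemma ip_norm_squared: "inner_product_on_space ip \<Longrightarrow> (ip_norm ip u)\<^sup>2 = ip u u"
  by (simp add: ip_norm_def inner_product_on_spaceD)

lemma ip_norm_scaleR:
  assumes "inner_product_on_space ip"
  shows "ip_norm ip (c *\<^sub>R u) = \<bar>c\<bar> * ip_norm ip u"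
  using inner_product_on_spaceD(1)[OF assms]
  by (simp add: ip_norm_def bilinear_lmul bilinear_rmul real_sqrt_mult flip: mult.assoc)

lemma ip_norm_minus_commute:
  assumes "inner_product_on_space ip"
  shows "ip_norm ip (u - v) = ip_norm ip (v - u)"
  using ip_norm_scaleR[OF assms, of "-1" "u - v"] by simp

lemma ip_norm_add_squared:
  assumes "inner_product_on_space ip"
  shows "(ip_norm ip (u + v))\<^sup>2 = (ip_norm ip u)\<^sup>2 + 2 * ip v u + (ip_norm ip v)\<^sup>2"
  using inner_product_on_spaceD(1)[OF assms] inner_product_on_spaceD(2)[OF assms, of u v]
  by (simp add: ip_norm_squared[OF assms] bilinear_ladd bilinear_radd)

lemma continuous_on_ip_norm:
  fixes ip :: "'v::euclidean_space \<Rightarrow> 'v \<Rightarrow> real"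
  assumes "inner_product_on_space ip" "continuous_on S f"
  shows "continuous_on S (\<lambda>x. ip_norm ip (f x))"
proof -
  have "bounded_bilinear ip"
    using inner_product_on_spaceD(1)[OF assms(1)] by (simp add: bilinear_conv_bounded_bilinear)
  then show ?thesis
    unfolding ip_norm_def
    by (rule continuous_on_real_sqrt[OF bounded_bilinear.continuous_on[OF _ assms(2) assms(2)]])
qed

text \<open>The constant is the minimum of \<open>ip_norm ip\<close> over the Euclidean unit sphere:
  compactness gives a minimiser, definiteness makes its value positive, and homogeneity carries the
  bound to every vector. It serves to bound the sublevel sets of \<open>ip_norm ip\<close>.\<close>

lemma ip_norm_bounded_below:
  fixes ip :: "'v::euclidean_space \<Rightarrow> 'v \<Rightarrow> real"
  assumes ip: "inner_product_on_space ip"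
  obtains m where "0 < m" "\<And>u. m * norm u \<le> ip_norm ip u"
proof -
  obtain e where e: "norm e = 1" "\<And>u. norm u = 1 \<Longrightarrow> ip_norm ip e \<le> ip_norm ip u"
    using continuous_attains_inf[OF compact_sphere, of 0 1 "ip_norm ip"]
      continuous_on_ip_norm[OF ip continuous_on_id] by auto
  show thesis
  proof
    have "e \<noteq> 0" using e(1) by auto
    then show "0 < ip_norm ip e"
      using ip by (simp add: ip_norm_def inner_product_on_space_def)
    fix u
    show "ip_norm ip e * norm u \<le> ip_norm ip u"
    proof (cases "u = 0")
      case False
      then have "ip_norm ip e \<le> ip_norm ip (inverse (norm u) *\<^sub>R u)" by (intro e(2)) simp
      then show ?thesis
        using False by (simp add: ip_norm_scaleR[OF ip] field_simps)
    qed (simp add: ip_norm_nonneg[OF ip])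
  qed
qed

text \<open>Only points of \<open>C\<close> at least as close to \<open>x\<close> as a fixed
  \<open>z\<close> in \<open>C\<close> can compete. They form a compact set \<open>K\<close>, on
  which the continuous distance attains its minimum.\<close>

lemma is_arg_min_ip_norm_exists:
  fixes ip :: "'v::euclidean_space \<Rightarrow> 'v \<Rightarrow> real"
  assumes ip: "inner_product_on_space ip" and "closed C" "C \<noteq> {}"
  shows "\<exists>r. is_arg_min (\<lambda>r. ip_norm ip (r - x)) (\<lambda>r. r \<in> C) r"
proof -
  obtain z where z: "z \<in> C" using assms(3) by blast
  obtain m where m: "0 < m" "\<And>u. m * norm u \<le> ip_norm ip u"
    using ip_norm_bounded_below[OF ip] by blast
  define K where "K = C \<inter> {r. ip_norm ip (r - x) \<le> ip_norm ip (z - x)}"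
  have cont: "continuous_on S (\<lambda>r. ip_norm ip (r - x))" for S
    by (intro continuous_on_ip_norm[OF ip] continuous_intros)
  have "closed K"
    unfolding K_def by (intro closed_Int assms closed_Collect_le cont continuous_intros)
  moreover have "K \<subseteq> cball x (ip_norm ip (z - x) / m)"
  proof
    fix r assume "r \<in> K"
    then have "m * norm (r - x) \<le> ip_norm ip (z - x)" using m(2)[of "r - x"] by (simp add: K_def)
    then show "r \<in> cball x (ip_norm ip (z - x) / m)"
      using m(1) by (simp add: dist_norm norm_minus_commute field_simps)
  qed
  ultimately have "compact K"
    using bounded_subset[OF bounded_cball] by (auto simp: compact_eq_bounded_closed)
  moreover have "z \<in> K" using z by (simp add: K_def)
  ultimately obtain r where r: "r \<in> K" "\<And>y. y \<in> K \<Longrightarrow> ip_norm ip (r - x) \<le> ip_norm ip (y - x)"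
    using continuous_attains_inf[of K, OF _ _ cont] by blast
  \<comment> \<open>A point \<open>y\<close> of \<open>C\<close> outside \<open>K\<close> is farther
    from \<open>x\<close> than \<open>z\<close>, and \<open>r\<close>, lying in \<open>K\<close>, is
    at least as close as \<open>z\<close>.\<close>
  have "ip_norm ip (r - x) \<le> ip_norm ip (y - x)" if "y \<in> C" for y
    using r(2)[of y] r(1) that by (fastforce simp: K_def)
  then show ?thesis
    using r(1) by (auto simp: K_def is_arg_min_linorder)
qed

text \<open>\<open>ARG_MIN\<close> is a Hilbert choice, so the existence of a minimiser is what
  gives the chosen point its property.\<close>

lemma ip_projection_is_arg_min:
  fixes ip :: "'v::euclidean_space \<Rightarrow> 'v \<Rightarrow> real"
  assumes "inner_product_on_space ip" "closed C" "C \<noteq> {}"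
  shows "is_arg_min (\<lambda>r'. ip_norm ip (r' - r)) (\<lambda>r'. r' \<in> C) (ip_projection ip C r)"
  unfolding ip_projection_def arg_min_def
  using is_arg_min_ip_norm_exists[OF assms] by (rule someI_ex)

lemma ip_projection:
  fixes ip :: "'v::euclidean_space \<Rightarrow> 'v \<Rightarrow> real"
  assumes "inner_product_on_space ip" "closed C" "C \<noteq> {}"
  shows "ip_projection ip C r \<in> C"
    and "q \<in> C \<Longrightarrow> ip_norm ip (r - ip_projection ip C r) \<le> ip_norm ip (r - q)"
  using ip_projection_is_arg_min[OF assms, of r]
  by (auto simp: is_arg_min_linorder ip_norm_minus_commute[OF assms(1), of r])

lemma closed_convex_coneD:
  assumes "closed_convex_cone C"
  shows "closed C" "C \<noteq> {}" "0 \<in> C" "0 \<le> c \<Longrightarrow> z \<in> C \<Longrightarrow> c *\<^sub>R z \<in> C"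
proof -
  have scale: "c *\<^sub>R z \<in> C" if "0 \<le> c" "z \<in> C" for c z
    using assms that unfolding closed_convex_cone_def by blast
  show "closed C" and nonempty: "C \<noteq> {}"
    using assms by (auto simp: closed_convex_cone_def)
  show "0 \<le> c \<Longrightarrow> z \<in> C \<Longrightarrow> c *\<^sub>R z \<in> C" by (rule scale)
  obtain z where "z \<in> C" using nonempty by blast
  then show "0 \<in> C" using scale[of 0 z] by simp
qed

text \<open>A witness \<open>q\<close> stands in for the minimal distance: any point of
  \<open>C\<close> meeting the bound suffices to continue the induction, and the final theorem only
  has to rescale it.\<close>

lemma blackwell_sum_distance:
  fixes C :: "'v::euclidean_space set" and ip :: "nat \<Rightarrow> 'v \<Rightarrow> 'v \<Rightarrow> real"
  assumes C: "closed C" "0 \<in> C"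
    and ip: "\<And>t. t \<ge> 1 \<Longrightarrow> inner_product_on_space (ip t)"
    and mono: "\<And>t u. t \<ge> 1 \<Longrightarrow> ip_norm (ip (t + 1)) u \<le> ip_norm (ip t) u"
    and orc: "blackwell_oracle A B R ip C orc"
    and \<rho>: "\<And>t. t \<ge> 1 \<Longrightarrow> \<rho> t \<in> R"
    and b: "\<And>t. t \<ge> 1 \<Longrightarrow> b t \<in> B"
    and "T \<ge> 1"
  shows "\<exists>q\<in>C. (ip_norm (ip T) ((\<Sum>t = 1..T. blackwell_outcome orc a1 \<rho> b t) - q))\<^sup>2
           \<le> (\<Sum>t = 1..T. (ip_norm (ip t) (blackwell_outcome orc a1 \<rho> b t))\<^sup>2)"
  using \<open>T \<ge> 1\<close>
proof (induction T rule: dec_induct)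
  case base
  \<comment> \<open>For \<open>T = 1\<close> the witness 0 gives equality whatever the first action
    is; the oracle has not been consulted yet.\<close>
  show ?case using C(2) by (intro bexI[of _ 0]) simp_all
next
  case (step n)
  define S where "S = (\<Sum>t = 1..n. blackwell_outcome orc a1 \<rho> b t)"
  define r where "r = blackwell_outcome orc a1 \<rho> b (Suc n)"
  define p where "p = ip_projection (ip (Suc n)) C S"
  obtain q where q: "q \<in> C" "(ip_norm (ip n) (S - q))\<^sup>2
      \<le> (\<Sum>t = 1..n. (ip_norm (ip t) (blackwell_outcome orc a1 \<rho> b t))\<^sup>2)"
    using step.IH unfolding S_def by blast
  have ip': "inner_product_on_space (ip (Suc n))" by (simp add: ip)
  have "C \<noteq> {}" using C(2) by blast
  note proj = ip_projection[OF ip' C(1) this]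
  \<comment> \<open>Since \<open>Suc n \<ge> 2\<close>, the action comes from the oracle queried at
    \<open>S\<close>, the sum up to \<open>n\<close>. Blackwell's condition therefore concerns
    \<open>S - p\<close>, with \<open>p\<close> projected from \<open>S\<close> in the norm of time
    \<open>Suc n\<close>.\<close>
  have "r = \<rho> (Suc n) (orc (Suc n) (\<rho> (Suc n)) S, b (Suc n))"
    using step.hyps blackwell_action_ge_2[of "Suc n" orc a1 \<rho> b]
    by (simp add: r_def S_def blackwell_outcome_def)
  then have cross: "ip (Suc n) r (S - p) \<le> 0"
    using orc \<rho>[of "Suc n"] b[of "Suc n"] unfolding blackwell_oracle_def p_def by simp
  have "ip_norm (ip (Suc n)) (S - p) \<le> ip_norm (ip (Suc n)) (S - q)"
    unfolding p_def by (rule proj(2)[OF q(1)])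
  \<comment> \<open>Monotonicity of the norms passes from time \<open>Suc n\<close> back to time
    \<open>n\<close>, where the induction hypothesis bounds the distance to
    \<open>q\<close>.\<close>
  also have "\<dots> \<le> ip_norm (ip n) (S - q)"
    using mono[OF step.hyps(1)] by simp
  finally have "(ip_norm (ip (Suc n)) (S - p))\<^sup>2 \<le> (ip_norm (ip n) (S - q))\<^sup>2"
    by (intro power_mono ip_norm_nonneg[OF ip'])
  \<comment> \<open>With this grouping the cross term of the expanded square is twice
    \<open>ip (Suc n) r (S - p)\<close>, which \<open>cross\<close> makes nonpositive.\<close>
  moreover have "S + r - p = (S - p) + r" by simp
  ultimately have "(ip_norm (ip (Suc n)) (S + r - p))\<^sup>2
      \<le> (\<Sum>t = 1..n. (ip_norm (ip t) (blackwell_outcome orc a1 \<rho> b t))\<^sup>2)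
        + (ip_norm (ip (Suc n)) r)\<^sup>2"
    using cross q(2) by (simp only: ip_norm_add_squared[OF ip'])
  moreover have "p \<in> C" unfolding p_def by (rule proj(1))
  ultimately show ?case
    by (intro bexI[of _ p]) (simp_all add: S_def r_def)
qed

theorem theorem3p1:
  fixes A :: "'a set" and B :: "'b set"
    and R :: "('a \<times> 'b \<Rightarrow> real ^ 'd) set"
    and C :: "(real ^ 'd) set"
    and ip :: "nat \<Rightarrow> real ^ 'd \<Rightarrow> real ^ 'd \<Rightarrow> real"
    and orc :: "nat \<Rightarrow> ('a \<times> 'b \<Rightarrow> real ^ 'd) \<Rightarrow> real ^ 'd \<Rightarrow> 'a"
    and a1 :: 'a
    and \<rho> :: "nat \<Rightarrow> 'a \<times> 'b \<Rightarrow> real ^ 'd"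
    and b :: "nat \<Rightarrow> 'b"
    and T :: nat
  assumes "closed_convex_cone C"
    and "\<And>t. t \<ge> 1 \<Longrightarrow> inner_product_on_space (ip t)"
    and "\<And>t u. t \<ge> 1 \<Longrightarrow> ip_norm (ip (t + 1)) u \<le> ip_norm (ip t) u"
    and "blackwell_condition A B R ip C"
    and "blackwell_oracle A B R ip C orc"
    and "a1 \<in> A"
    and "\<And>t. t \<ge> 1 \<Longrightarrow> \<rho> t \<in> R"
    and "\<And>t. t \<ge> 1 \<Longrightarrow> b t \<in> B"
    and "T \<ge> 1"
  shows "\<exists>r. is_arg_min
               (\<lambda>r. ip_norm (ip T)
                  ((1 / real T) *\<^sub>R (\<Sum>t = 1..T. blackwell_outcome orc a1 \<rho> b t) - r))
               (\<lambda>r. r \<in> C) r \<and>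
             ip_norm (ip T) ((1 / real T) *\<^sub>R (\<Sum>t = 1..T. blackwell_outcome orc a1 \<rho> b t) - r)
               \<le> 1 / real T * sqrt (\<Sum>t = 1..T. (ip_norm (ip t) (blackwell_outcome orc a1 \<rho> b t))\<^sup>2)"
proof -
  define S where "S = (\<Sum>t = 1..T. blackwell_outcome orc a1 \<rho> b t)"
  define V where "V = (\<Sum>t = 1..T. (ip_norm (ip t) (blackwell_outcome orc a1 \<rho> b t))\<^sup>2)"
  note C = closed_convex_coneD[OF assms(1)]
  have ip: "inner_product_on_space (ip T)" by (rule assms(2)[OF \<open>T \<ge> 1\<close>])
  obtain q where q: "q \<in> C" "(ip_norm (ip T) (S - q))\<^sup>2 \<le> V"
  proof -
    have "\<exists>q\<in>C. (ip_norm (ip T) (S - q))\<^sup>2 \<le> V"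
      unfolding S_def V_def by (rule blackwell_sum_distance[where R = R]) (use C assms in auto)
    then show thesis using that by blast
  qed
  obtain r where r: "is_arg_min (\<lambda>r. ip_norm (ip T) ((1 / real T) *\<^sub>R S - r)) (\<lambda>r. r \<in> C) r"
    using is_arg_min_ip_norm_exists[OF ip C(1,2), of "(1 / real T) *\<^sub>R S"]
    by (auto simp: ip_norm_minus_commute[OF ip, of "(1 / real T) *\<^sub>R S"])
  \<comment> \<open>The cone property makes the rescaled witness a competitor of the minimiser
    \<open>r\<close>, and homogeneity of the norm then pulls out the factor
    \<open>1 / real T\<close>.\<close>
  have "(1 / real T) *\<^sub>R q \<in> C" by (rule C(4)) (simp_all add: q)
  then have "ip_norm (ip T) ((1 / real T) *\<^sub>R S - r)
      \<le> ip_norm (ip T) ((1 / real T) *\<^sub>R S - (1 / real T) *\<^sub>R q)"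
    using r by (simp add: is_arg_min_linorder)
  also have "\<dots> = 1 / real T * ip_norm (ip T) (S - q)"
    by (simp add: ip_norm_scaleR[OF ip] flip: scaleR_diff_right)
  also have "\<dots> \<le> 1 / real T * sqrt V"
    using q(2) by (intro mult_left_mono real_le_rsqrt) simp_all
  finally show ?thesis
    using r unfolding S_def V_def by blast
qed

end
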